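(* Let $0<\delta<1/5$, let $0<s_0<p$ be integers and let $k_0>0$. Let $A$ be a $q\times p$ real matrix such that the condition $\mathsf{RE}(s_0,3k_0,A)$ holds with $0<K(s_0,3k_0,A)<\infty$. Set $$d = s_0+s_0\,\max_{j}\|Ae_j\|_2^2\left(\frac{16K^2(s_0,3k_0,A)(3k_0)^2(3k_0+1)}{\delta^2}\right),$$ and let $E=\bigcup_{|J|\le d}E_J$ (union over $J\subset\{1,\dots,p\}$) if $d<p$, and $E=\mathbb{R}^p$ otherwise. Let $\tilde\Psi$ be a real matrix with $q$ columns such that $$\forall x\in AE:\quad (1-\delta)\|x\|_2\le\|\tilde\Psi x\|_2\le(1+\delta)\|x\|_2 .$$ Then for every $x\in A\big(\mathrm{Cone}(s_0,k_0)\big)\cap S^{q-1}$, $$1-5\delta\le\|\tilde\Psi x\|_2\le1+3\delta .$$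
   Context: $e_1,\dots,e_p$ is the canonical basis of $\mathbb{R}^p$; for $J\subset\{1,\dots,p\}$, $E_J=\mathrm{span}\{e_j:j\in J\}$, $J^c$ is the complement of $J$, and $v_J$ is the restriction of $v\in\mathbb{R}^p$ to coordinates in $J$. $S^{q-1}$ is the Euclidean unit sphere of $\mathbb{R}^q$. For a set $V\subset\mathbb{R}^p$, $AV=\{Ax:x\in V\}$. $\mathrm{Cone}(s_0,k_0)=\{x\in\mathbb{R}^p:\ \exists I\subset\{1,\dots,p\},\ |I|=s_0,\ \|x_{I^c}\|_1\le k_0\|x_I\|_1\}$. Restricted Eigenvalue condition: for an integer $1\le s_0\le p$ and $k_0>0$, a matrix $A$ with $p$ columns satisfies $\mathsf{RE}(s_0,k_0,A)$ with parameter $K(s_0,k_0,A)$ if $$\frac1{K(s_0,k_0,A)}:=\min_{J\subseteq\{1,\dots,p\},\,|J|\le s_0}\ \min_{v\ne0,\ \|v_{J^c}\|_1\le k_0\|v_J\|_1}\frac{\|Av\|_2}{\|v_J\|_2}>0 .$$ *)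

theory Defs
  imports "HOL-Analysis.Analysis"
begin

definition unit_span :: "'p set \<Rightarrow> (real ^ 'p) set"
  where "unit_span J = span ((\<lambda>j. axis j 1) ` J)"

text \<open>The restriction of \<open>v\<close> to the coordinates in \<open>J\<close>, padded with zeros outside \<open>J\<close>.\<close>
definition restr :: "'p set \<Rightarrow> real ^ 'p \<Rightarrow> real ^ 'p"
  where "restr J v = (\<chi> j. if j \<in> J then v $ j else 0)"

definition l1_norm :: "real ^ 'p \<Rightarrow> real"
  where "l1_norm v = (\<Sum>j\<in>UNIV. \<bar>v $ j\<bar>)"

definition Cone :: "nat \<Rightarrow> real \<Rightarrow> (real ^ 'p) set"
  where "Cone s0 k0 =
    {x. \<exists>I. card I = s0 \<and> l1_norm (restr (- I) x) \<le> k0 * l1_norm (restr I x)}"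

text \<open>The cone constraint with \<open>v \<noteq> 0\<close> forces \<open>restr J v \<noteq> 0\<close>, so no quotient below divides by
  zero, and \<open>J = {}\<close> contributes nothing.\<close>
definition RE_ratios :: "nat \<Rightarrow> real \<Rightarrow> real ^ 'p ^ 'q \<Rightarrow> real set"
  where "RE_ratios s0 k0 A =
    {norm (A *v v) / norm (restr J v) | J v.
       card J \<le> s0 \<and> v \<noteq> 0 \<and> l1_norm (restr (- J) v) \<le> k0 * l1_norm (restr J v)}"

text \<open>The minimum of an infinite set of reals; \<open>RE_min_attained\<close> below shows that it exists.\<close>
definition RE_min :: "nat \<Rightarrow> real \<Rightarrow> real ^ 'p ^ 'q \<Rightarrow> real"
  where "RE_min s0 k0 A = (LEAST r. r \<in> RE_ratios s0 k0 A)"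

definition RE :: "nat \<Rightarrow> real \<Rightarrow> real ^ 'p ^ 'q \<Rightarrow> bool"
  where "RE s0 k0 A \<longleftrightarrow> RE_min s0 k0 A > 0"

text \<open>Real-valued, hence finite; it is \<open>1 / 0 = 0\<close> rather than infinite when \<open>RE\<close> fails.\<close>
definition RE_K :: "nat \<Rightarrow> real \<Rightarrow> real ^ 'p ^ 'q \<Rightarrow> real"
  where "RE_K s0 k0 A = 1 / RE_min s0 k0 A"

lemma restr_scaleR: "restr J (c *\<^sub>R v) = c *\<^sub>R restr J v"
  by (simp add: restr_def vec_eq_iff)

lemma l1_norm_scaleR: "l1_norm (c *\<^sub>R v) = \<bar>c\<bar> * l1_norm v"
  by (simp add: l1_norm_def abs_mult sum_distrib_left)

lemma l1_norm_eq_0: "l1_norm v \<le> 0 \<Longrightarrow> v = 0"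
proof -
  assume "l1_norm v \<le> 0"
  moreover have "0 \<le> l1_norm v" by (simp add: l1_norm_def sum_nonneg)
  ultimately have "l1_norm v = 0" by simp
  thus "v = 0" by (simp add: l1_norm_def sum_nonneg_eq_0_iff vec_eq_iff)
qed

lemma restr_nonzero:
  assumes "v \<noteq> 0" "l1_norm (restr (- J) v) \<le> k0 * l1_norm (restr J v)"
  shows "restr J v \<noteq> 0"
proof
  assume z: "restr J v = 0"
  hence "restr (- J) v = 0" using assms(2) by (intro l1_norm_eq_0) (simp add: l1_norm_def)
  with z have "v $ j = 0" for j
    by (cases "j \<in> J") (simp_all add: restr_def vec_eq_iff, metis+)
  with assms(1) show False by (simp add: vec_eq_iff)
qed

lemma continuous_on_restr [continuous_intros]: "continuous_on S (restr J)"
  unfolding restr_def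
  by (rule continuous_on_vec_lambda, rename_tac j, case_tac "j \<in> J")
     (auto intro!: continuous_intros)

lemma continuous_on_l1_restr [continuous_intros]: "continuous_on S (\<lambda>v. l1_norm (restr J v))"
  unfolding l1_norm_def by (intro continuous_intros)

lemma RE_min_attained:
  fixes A :: "real ^ 'p ^ 'q"
  assumes "1 \<le> s0" "0 \<le> k0"
  shows "RE_min s0 k0 A \<in> RE_ratios s0 k0 A"
    and "r \<in> RE_ratios s0 k0 A \<Longrightarrow> RE_min s0 k0 A \<le> r"
proof -
  define C where "C J = sphere 0 1 \<inter> {v::real^'p. l1_norm (restr (- J) v) \<le> k0 * l1_norm (restr J v)}" for J
  define f where "f J v = norm (A *v v) / norm (restr J v)" for J and v :: "real^'p"
  have eq: "RE_ratios s0 k0 A = (\<Union>J\<in>{J. card J \<le> s0}. f J ` C J)" (is "_ = ?T")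
  proof (intro equalityI subsetI)
    fix r assume "r \<in> RE_ratios s0 k0 A"
    then obtain J v where *: "r = f J v" "card J \<le> s0" "v \<noteq> 0"
        "l1_norm (restr (- J) v) \<le> k0 * l1_norm (restr J v)"
      by (auto simp: RE_ratios_def f_def)
    define w where "w = (1 / norm v) *\<^sub>R v"
    have "f J w = f J v"
      using \<open>v \<noteq> 0\<close> by (simp add: f_def w_def restr_scaleR matrix_vector_mult_scaleR)
    moreover have "w \<in> C J"
      using *(3,4) by (simp add: C_def w_def restr_scaleR l1_norm_scaleR field_simps)
    ultimately have "r \<in> f J ` C J" using *(1) by (metis imageI)
    then show "r \<in> ?T" using *(2) by blast
  next
    fix r assume "r \<in> ?T"
    then show "r \<in> RE_ratios s0 k0 A"
      by (force simp: RE_ratios_def f_def C_def)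
  qed
  have "compact (f J ` C J)" for J
  proof (rule compact_continuous_image)
    have "closed {v::real^'p. l1_norm (restr (- J) v) \<le> k0 * l1_norm (restr J v)}"
      by (intro closed_Collect_le continuous_intros)
    thus "compact (C J)" unfolding C_def by (intro compact_Int_closed) auto
    have "restr J v \<noteq> 0" if "v \<in> C J" for v
      using that by (intro restr_nonzero[of v J k0]) (auto simp: C_def)
    thus "continuous_on (C J) (f J)"
      unfolding f_def
      by (intro continuous_intros matrix_vector_mult_linear_continuous_on) auto
  qed
  hence "compact (RE_ratios s0 k0 A)" unfolding eq by (intro compact_UN) auto
  moreover have "RE_ratios s0 k0 A \<noteq> {}"
  proof -
    fix j :: 'p
    have "restr (- {j}) (axis j 1 :: real^'p) = 0" by (auto simp: restr_def axis_def vec_eq_iff)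
    hence "norm (A *v axis j 1) / norm (restr {j} (axis j 1)) \<in> RE_ratios s0 k0 A"
      using assms unfolding RE_ratios_def
      by (intro CollectI exI[of _ "{j}"] exI[of _ "axis j 1"])
         (auto simp: l1_norm_def axis_eq_0_iff intro!: mult_nonneg_nonneg sum_nonneg)
    thus ?thesis by auto
  qed
  ultimately obtain m where m: "m \<in> RE_ratios s0 k0 A" "\<forall>r\<in>RE_ratios s0 k0 A. m \<le> r"
    using compact_attains_inf by blast
  hence "RE_min s0 k0 A = m" unfolding RE_min_def by (intro Least_equality) auto
  with m show "RE_min s0 k0 A \<in> RE_ratios s0 k0 A"
    and "r \<in> RE_ratios s0 k0 A \<Longrightarrow> RE_min s0 k0 A \<le> r" by auto
qed

end

theory Submission
  imports Defs
begin

text \<open>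
  Split \<open>x\<close> in the cone as \<open>c + t\<close>, where \<open>c = restr I x\<close>, and write the tail \<open>t\<close> as a convex
  combination of atoms \<open>u j = \<plusminus>\<parallel>t\<parallel>\<^sub>1 e\<^sub>j\<close>. If \<open>y\<close> is \<open>c\<close> plus the mean of \<open>m\<close> independent random
  atoms, then every quadratic form \<open>Q\<close>, definite or not, satisfies
  \<open>\<bbbE> Q y = Q x + (\<bbbE> Q u - Q t) / m\<close>. The vectors \<open>y\<close>, \<open>u j\<close> are sparse, so taking
  \<open>Q v = \<parallel>\<Psi> A v\<parallel>\<^sup>2 - (1 \<plusminus> \<delta>)\<^sup>2 \<parallel>A v\<parallel>\<^sup>2\<close>, whose sign is known on sparse vectors, bounds
  \<open>\<parallel>\<Psi> A x\<parallel>\<close> on both sides; the restricted eigenvalue condition makes the error term small,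
  since it bounds \<open>\<parallel>t\<parallel>\<^sub>1\<close> by \<open>k0 \<surd>s0 K \<parallel>A x\<parallel>\<close>.
\<close>

section \<open>Averaging and the greedy choice of atoms\<close>

text \<open>If every value exceeded the mean, the weighted deviations would be nonnegative with sum
  zero, forcing all weights to vanish. This replaces the choice of a random atom.\<close>

lemma exists_le_weighted_mean:
  fixes w f :: "'i \<Rightarrow> real"
  assumes "finite S" "\<And>i. i \<in> S \<Longrightarrow> 0 \<le> w i" "sum w S = 1"
  obtains i where "i \<in> S" "f i \<le> (\<Sum>i\<in>S. w i * f i)"
proof (rule ccontr)
  assume "\<not> thesis"
  with that have gt: "(\<Sum>i\<in>S. w i * f i) < f i" if "i \<in> S" for i
    using \<open>i \<in> S\<close> not_le by blast
  define \<mu> where "\<mu> = (\<Sum>i\<in>S. w i * f i)"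
  have pos: "0 \<le> w i * (f i - \<mu>)" if "i \<in> S" for i
    using assms(2)[OF that] gt[OF that] by (simp add: \<mu>_def)
  have "(\<Sum>i\<in>S. w i * (f i - \<mu>)) = 0"
    by (simp add: right_diff_distrib sum_subtractf flip: sum_distrib_right \<mu>_def) (simp add: assms(3))
  then have "w i * (f i - \<mu>) = 0" if "i \<in> S" for i
    using sum_nonneg_eq_0_iff[of S "\<lambda>i. w i * (f i - \<mu>)"] assms(1) pos that by simp
  then have "w i = 0" if "i \<in> S" for i
    using gt[OF that] that by (fastforce simp: \<mu>_def)
  then show False
    using assms(3) by simp
qed

text \<open>A derandomised Maurey argument: the atoms are chosen greedily, each step not exceeding the
  mean over the next atom.\<close>
lemma bilinear_greedy_sum:
  fixes h :: "'a::real_vector \<Rightarrow> 'a \<Rightarrow> real" and u :: "'i \<Rightarrow> 'a"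
  assumes h: "bilinear h"
    and S: "finite S" "\<And>i. i \<in> S \<Longrightarrow> 0 \<le> w i" "sum w S = 1"
    and t: "t = (\<Sum>i\<in>S. w i *\<^sub>R u i)"
  obtains g where "g ` {..<n} \<subseteq> S"
    and "h (p + r *\<^sub>R (\<Sum>i<n. u (g i) - t)) (p + r *\<^sub>R (\<Sum>i<n. u (g i) - t))
      \<le> h p p + real n * r\<^sup>2 * ((\<Sum>i\<in>S. w i * h (u i) (u i)) - h t t)"
proof -
  define V where "V = (\<Sum>i\<in>S. w i * h (u i) (u i)) - h t t"
  have "\<exists>g. g ` {..<n} \<subseteq> S \<and>
    h (p + r *\<^sub>R (\<Sum>i<n. u (g i) - t)) (p + r *\<^sub>R (\<Sum>i<n. u (g i) - t)) \<le> h p p + real n * r\<^sup>2 * V"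
  proof (induction n)
    case (Suc n)
    then obtain g where g: "g ` {..<n} \<subseteq> S"
      "h (p + r *\<^sub>R (\<Sum>i<n. u (g i) - t)) (p + r *\<^sub>R (\<Sum>i<n. u (g i) - t)) \<le> h p p + real n * r\<^sup>2 * V"
      by blast
    define z where "z = p + r *\<^sub>R (\<Sum>i<n. u (g i) - t)"
    \<comment> \<open>\<open>a\<close> is chosen so that the candidates
      \<open>a + r *\<^sub>R u j\<close> for the next point have weighted mean
      \<open>z\<close>.\<close>
    define a where "a = z - r *\<^sub>R t"
    have lin: "linear (h v)" "linear (\<lambda>v'. h v' v)" for v
      using h by (auto simp: bilinear_def)
    have sums: "(\<Sum>i\<in>S. w i * h a (u i)) = h a t" "(\<Sum>i\<in>S. w i * h (u i) a) = h t a"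
      by (simp_all add: t linear_sum[OF lin(1)] linear_sum[OF lin(2)]
          linear_cmul[OF lin(1)] linear_cmul[OF lin(2)])
    have exp: "h (v + r *\<^sub>R v') (v + r *\<^sub>R v') = h v v + r * h v v' + r * h v' v + r\<^sup>2 * h v' v'" for v v'
      using h by (simp add: bilinear_ladd bilinear_radd bilinear_lmul bilinear_rmul
          power2_eq_square algebra_simps)
    \<comment> \<open>The cross terms are linear in the atom, so averaging turns them into those of
      \<open>t\<close>. Only the quadratic term leaves an excess, namely
      \<open>r\<^sup>2 * V\<close>.\<close>
    have "(\<Sum>i\<in>S. w i * h (a + r *\<^sub>R u i) (a + r *\<^sub>R u i))
        = (\<Sum>i\<in>S. w i * h a a) + r * (\<Sum>i\<in>S. w i * h a (u i)) + r * (\<Sum>i\<in>S. w i * h (u i) a)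
          + r\<^sup>2 * (\<Sum>i\<in>S. w i * h (u i) (u i))"
      unfolding exp by (simp add: sum_distrib_left distrib_left sum.distrib mult_ac)
    also have "\<dots> = h a a + r * h a t + r * h t a + r\<^sup>2 * h t t + r\<^sup>2 * V"
      by (simp add: sums V_def S(3) right_diff_distrib flip: sum_distrib_right)
    also have "\<dots> = h z z + r\<^sup>2 * V"
      using exp[of a t] by (simp add: a_def)
    finally obtain j where j: "j \<in> S" "h (a + r *\<^sub>R u j) (a + r *\<^sub>R u j) \<le> h z z + r\<^sup>2 * V"
      using exists_le_weighted_mean[of S w "\<lambda>i. h (a + r *\<^sub>R u i) (a + r *\<^sub>R u i)"] S by metis
    define g' where "g' = g(n := j)"
    have "g' ` {..<Suc n} \<subseteq> S"
      using g(1) j(1) by (auto simp: g'_def lessThan_Suc image_subset_iff)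
    moreover have "(\<Sum>i<n. u (g' i) - t) = (\<Sum>i<n. u (g i) - t)"
      by (intro sum.cong) (auto simp: g'_def)
    then have "p + r *\<^sub>R (\<Sum>i<Suc n. u (g' i) - t) = a + r *\<^sub>R u j"
      by (simp add: a_def z_def g'_def algebra_simps)
    ultimately show ?case
      using j(2) g(2) by (intro exI[of _ g']) (auto simp: z_def algebra_simps)
  qed auto
  with that show thesis
    unfolding V_def by blast
qed

section \<open>Restrictions, sparse supports and the l1 norm\<close>

lemma restr_add_restr_Compl: "restr J v + restr (- J) v = v"
  by (simp add: restr_def vec_eq_iff)

lemma axis_eq_scaleR: "axis j c = c *\<^sub>R axis j 1" for c :: real
  by (simp add: axis_def vec_eq_iff)

lemma axis_in_unit_span: "j \<in> J \<Longrightarrow> axis j c \<in> unit_span J"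
  unfolding unit_span_def by (subst axis_eq_scaleR) (intro span_scale span_base imageI)

lemma vec_eq_sum_axis: "(v :: real ^ 'p) = (\<Sum>j\<in>UNIV. axis j (v $ j))"
  by (simp add: vec_eq_iff axis_def)

lemma restr_in_unit_span: "restr J v \<in> unit_span J"
proof -
  have "axis j (restr J v $ j) \<in> unit_span J" for j
    using axis_in_unit_span[of j J]
    by (cases "j \<in> J") (simp_all add: restr_def unit_span_def axis_eq_0_iff[THEN iffD2] span_zero)
  then have "(\<Sum>j\<in>UNIV. axis j (restr J v $ j)) \<in> unit_span J"
    unfolding unit_span_def by (intro span_sum)
  then show ?thesis
    by (simp flip: vec_eq_sum_axis)
qed

text \<open>The triangle inequality over the coordinate expansion. It controls the image of the
  tail, whose support may be too large for the isometry hypothesis.\<close>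

lemma norm_linear_le_l1_norm:
  fixes f :: "real ^ 'p \<Rightarrow> 'a::real_normed_vector"
  assumes f: "linear f" and b: "\<And>j. norm (f (axis j 1)) \<le> b"
  shows "norm (f v) \<le> l1_norm v * b"
proof -
  have "f v = (\<Sum>j\<in>UNIV. v $ j *\<^sub>R f (axis j 1))"
    by (subst vec_eq_sum_axis[of v], subst axis_eq_scaleR) (simp add: linear_sum[OF f] linear_cmul[OF f])
  also have "norm \<dots> \<le> (\<Sum>j\<in>UNIV. \<bar>v $ j\<bar> * b)"
    by (intro sum_norm_le) (simp add: mult_left_mono b)
  finally show ?thesis
    by (simp add: l1_norm_def sum_distrib_right)
qed

lemma l1_norm_restr_le: "l1_norm (restr J v) \<le> sqrt (card J) * norm (restr J v)"
proof -
  have "l1_norm (restr J v) = (\<Sum>j\<in>J. \<bar>restr J v $ j\<bar>)"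
    unfolding l1_norm_def by (intro sum.mono_neutral_right) (auto simp: restr_def)
  also have "\<dots> = (\<Sum>j\<in>J. \<bar>1\<bar> * \<bar>restr J v $ j\<bar>)"
    by simp
  also have "\<dots> \<le> L2_set (\<lambda>_. 1) J * L2_set (($) (restr J v)) J"
    by (rule L2_set_mult_ineq)
  also have "\<dots> \<le> sqrt (card J) * norm (restr J v)"
    by (intro mult_mono)
       (auto simp: L2_set_def norm_vec_def intro!: sum_mono2 sum_nonneg)
  finally show ?thesis .
qed

section \<open>From sparse vectors to general ones\<close>

text \<open>Replacing the tail by a mean of \<open>m\<close> atoms gives a vector supported on
  \<open>I\<close> and at most \<open>m\<close> further indices, where \<open>h\<close> is
  nonnegative. The greedy choice raises \<open>h\<close> above \<open>h x x\<close> by at most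
  \<open>1 / m\<close> times the excess, which \<open>b\<close> and \<open>b'\<close> bound through
  the atoms and the tail.\<close>

lemma sparse_mean_bound:
  fixes h :: "real ^ 'p \<Rightarrow> real ^ 'p \<Rightarrow> real"
  assumes h: "bilinear h" and m: "0 < m"
    and sparse: "\<And>J v. card J \<le> card I + m \<Longrightarrow> v \<in> unit_span J \<Longrightarrow> 0 \<le> h v v"
    and b: "\<And>j. h (axis j 1) (axis j 1) \<le> b"
    and tail: "- h (restr (- I) x) (restr (- I) x) \<le> b'"
  shows "- (((l1_norm (restr (- I) x))\<^sup>2 * b + b') / m) \<le> h x x"
proof -
  define t where "t = restr (- I) x"
  define L where "L = l1_norm t"
  show ?thesis
  \<comment> \<open>The weights below divide by \<open>L\<close>. For a vanishing tail,
    \<open>x\<close> is itself sparse.\<close>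
  proof (cases "L = 0")
    case True
    then have "t = 0"
      by (intro l1_norm_eq_0) (simp add: L_def)
    then have "x \<in> unit_span I"
      using restr_in_unit_span[of I x] restr_add_restr_Compl[of I x] by (simp add: t_def)
    moreover have "0 \<le> b'"
      using tail \<open>t = 0\<close> h by (simp add: t_def bilinear_lzero)
    ultimately show ?thesis
      using sparse[of I x] True m by (simp add: L_def t_def)
        (meson divide_nonneg_nonneg neg_le_0_iff_le of_nat_0_le_iff order_trans)
  next
    case False
    then have L: "0 < L"
      by (simp add: L_def l1_norm_def sum_nonneg less_le)
    define w where "w = (\<lambda>j. \<bar>t $ j\<bar> / L)"
    define u :: "'p \<Rightarrow> real ^ 'p" where "u = (\<lambda>j. axis j (L * sgn (t $ j)))"
    have u: "u j = (L * sgn (t $ j)) *\<^sub>R axis j 1" for j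
      unfolding u_def by (rule axis_eq_scaleR)
    have "t = (\<Sum>j\<in>UNIV. w j *\<^sub>R u j)"
      using L by (simp add: vec_eq_iff w_def u_def axis_def if_distrib mult_sgn_abs cong: if_cong)
         (simp add: abs_mult_sgn)
    moreover have "sum w UNIV = 1"
      using L by (simp add: w_def L_def l1_norm_def flip: sum_divide_distrib)
    moreover have "0 \<le> w j" for j
      using L by (simp add: w_def)
    \<comment> \<open>Starting at \<open>x\<close> with step \<open>1 / m\<close>, the
      \<open>m\<close> steps remove the whole tail and insert the mean of the chosen atoms.\<close>
    ultimately obtain g where g: "h (x + (1 / m) *\<^sub>R (\<Sum>i<m. u (g i) - t)) (x + (1 / m) *\<^sub>R (\<Sum>i<m. u (g i) - t))
      \<le> h x x + real m * (1 / m)\<^sup>2 * ((\<Sum>j\<in>UNIV. w j * h (u j) (u j)) - h t t)"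
      using bilinear_greedy_sum[OF h, of UNIV w t u m x "1 / m"] by auto
    define J where "J = I \<union> g ` {..<m}"
    have "u (g i) \<in> unit_span J" if "i < m" for i
      using that by (auto simp: u_def J_def intro: axis_in_unit_span)
    then have "(1 / m) *\<^sub>R (\<Sum>i<m. u (g i)) \<in> unit_span J"
      unfolding unit_span_def by (intro span_scale span_sum) auto
    moreover have "restr I x \<in> unit_span J"
      using restr_in_unit_span[of I x] span_mono[of "(\<lambda>j. axis j 1) ` I" "(\<lambda>j. axis j 1) ` J"]
      by (auto simp: unit_span_def J_def)
    moreover have "x - t = restr I x"
      using restr_add_restr_Compl[of I x] by (simp add: t_def algebra_simps)
    then have "x + (1 / m) *\<^sub>R (\<Sum>i<m. u (g i) - t) = restr I x + (1 / m) *\<^sub>R (\<Sum>i<m. u (g i))"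
      using m by (simp add: sum_subtractf scaleR_diff_right sum_constant_scaleR algebra_simps del: sum_constant)
    moreover have "card J \<le> card I + m"
      unfolding J_def using card_Un_le[of I "g ` {..<m}"] card_image_le[of "{..<m}" g] by simp
    ultimately have "0 \<le> h x x + real m * (1 / m)\<^sup>2 * ((\<Sum>j\<in>UNIV. w j * h (u j) (u j)) - h t t)"
      using g sparse[of J "restr I x + (1 / m) *\<^sub>R (\<Sum>i<m. u (g i))"]
      by (simp add: unit_span_def span_add)
    moreover have "(\<Sum>j\<in>UNIV. w j * h (u j) (u j)) \<le> (\<Sum>j\<in>UNIV. w j * (L\<^sup>2 * b))"
    proof (rule sum_mono)
      fix j
      \<comment> \<open>The squared sign is 1 unless \<open>t $ j = 0\<close>, and then
        \<open>w j = 0\<close> makes both sides vanish.\<close>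
      have "w j * h (u j) (u j) = w j * (L\<^sup>2 * h (axis j 1) (axis j 1))"
        using h by (simp add: u bilinear_lmul bilinear_rmul power2_eq_square w_def sgn_if)
      also have "\<dots> \<le> w j * (L\<^sup>2 * b)"
        using \<open>0 \<le> w j\<close> by (intro mult_left_mono b) auto
      finally show "w j * h (u j) (u j) \<le> w j * (L\<^sup>2 * b)" .
    qed
    then have "(\<Sum>j\<in>UNIV. w j * h (u j) (u j)) \<le> L\<^sup>2 * b"
      using \<open>sum w UNIV = 1\<close> by (simp flip: sum_distrib_right)
    with tail have "real m * (1 / m)\<^sup>2 * ((\<Sum>j\<in>UNIV. w j * h (u j) (u j)) - h t t)
        \<le> real m * (1 / m)\<^sup>2 * (L\<^sup>2 * b + b')"
      by (intro mult_left_mono) (auto simp: t_def)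
    ultimately show ?thesis
      using m by (simp add: L_def t_def power2_eq_square)
  qed
qed

text \<open>Each bound is \<open>sparse_mean_bound\<close> for a form that is nonnegative on sparse
  vectors. The factor 2 in \<open>B\<close> arises because the atoms and the tail contribute the
  same bound.\<close>

lemma sparse_isometry_transfer:
  fixes F :: "real ^ 'p \<Rightarrow> 'a::real_inner" and G :: "real ^ 'p \<Rightarrow> 'b::real_inner"
    and x :: "real ^ 'p"
  assumes F: "linear F" and G: "linear G" and m: "0 < m" and \<delta>: "0 \<le> \<delta>" "\<delta> \<le> 1"
    and sparse: "\<And>J v. card J \<le> card I + m \<Longrightarrow> v \<in> unit_span J \<Longrightarrow>
      (1 - \<delta>) * norm (F v) \<le> norm (G v) \<and> norm (G v) \<le> (1 + \<delta>) * norm (F v)"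
    and R: "\<And>j. norm (F (axis j 1)) \<le> R"
  defines "B \<equiv> 2 * (1 + \<delta>)\<^sup>2 * (l1_norm (restr (- I) x) * R)\<^sup>2 / m"
  shows "(norm (G x))\<^sup>2 \<le> (1 + \<delta>)\<^sup>2 * (norm (F x))\<^sup>2 + B"
    and "(1 - \<delta>)\<^sup>2 * (norm (F x))\<^sup>2 - B \<le> (norm (G x))\<^sup>2"
proof -
  define t where "t = restr (- I) x"
  \<comment> \<open>The coefficients \<open>c\<close>, \<open>e\<close> are \<open>-1\<close>,
    \<open>(1 + \<delta>)\<^sup>2\<close> for the upper bound and \<open>1\<close>,
    \<open>- ((1 - \<delta>)\<^sup>2)\<close> for the lower one.\<close>
  have blin: "bilinear (\<lambda>v v'. c * (G v \<bullet> G v') + e * (F v \<bullet> F v'))" for c e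
    unfolding bilinear_def
    by (auto intro!: linearI
        simp: linear_add[OF F] linear_add[OF G] linear_cmul[OF F] linear_cmul[OF G]
          inner_add_left inner_add_right algebra_simps)
  have Ge: "norm (G (axis j 1)) \<le> (1 + \<delta>) * R" for j
  proof -
    have "norm (G (axis j 1)) \<le> (1 + \<delta>) * norm (F (axis j 1))"
      using sparse[of "{j}" "axis j 1"] m axis_in_unit_span[of j "{j}" 1] by simp
    also have "\<dots> \<le> (1 + \<delta>) * R"
      using R \<delta> by (intro mult_left_mono) auto
    finally show ?thesis .
  qed
  have Ft: "norm (F t) \<le> l1_norm t * R" and Gt: "norm (G t) \<le> l1_norm t * ((1 + \<delta>) * R)"
    using norm_linear_le_l1_norm F G R Ge by blast+
  have "- (((l1_norm t)\<^sup>2 * ((1 + \<delta>)\<^sup>2 * R\<^sup>2) + (1 + \<delta>)\<^sup>2 * (l1_norm t * R)\<^sup>2) / m)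
      \<le> (-1) * (G x \<bullet> G x) + (1 + \<delta>)\<^sup>2 * (F x \<bullet> F x)"
    unfolding t_def
  proof (rule sparse_mean_bound[OF blin m])
    fix J and v :: "real ^ 'p" assume "card J \<le> card I + m" "v \<in> unit_span J"
    then have "(norm (G v))\<^sup>2 \<le> ((1 + \<delta>) * norm (F v))\<^sup>2"
      using sparse by (intro power_mono) auto
    then show "0 \<le> -1 * (G v \<bullet> G v) + (1 + \<delta>)\<^sup>2 * (F v \<bullet> F v)"
      by (simp add: power_mult_distrib power2_norm_eq_inner)
  next
    fix j
    have "(1 + \<delta>)\<^sup>2 * (norm (F (axis j 1)))\<^sup>2 \<le> (1 + \<delta>)\<^sup>2 * R\<^sup>2"
      using R by (intro mult_left_mono power_mono) auto
    then show "-1 * (G (axis j 1) \<bullet> G (axis j 1)) + (1 + \<delta>)\<^sup>2 * (F (axis j 1) \<bullet> F (axis j 1))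
        \<le> (1 + \<delta>)\<^sup>2 * R\<^sup>2"
      unfolding power2_norm_eq_inner using inner_ge_zero[of "G (axis j 1)"] by linarith
  next
    have "(norm (G t))\<^sup>2 \<le> (l1_norm t * ((1 + \<delta>) * R))\<^sup>2"
      using Gt by (intro power_mono) auto
    moreover have "0 \<le> (1 + \<delta>)\<^sup>2 * (norm (F t))\<^sup>2"
      by simp
    ultimately have "(norm (G t))\<^sup>2 - (1 + \<delta>)\<^sup>2 * (norm (F t))\<^sup>2 \<le> (l1_norm t * ((1 + \<delta>) * R))\<^sup>2"
      by linarith
    then show "- (-1 * (G (restr (- I) x) \<bullet> G (restr (- I) x))
        + (1 + \<delta>)\<^sup>2 * (F (restr (- I) x) \<bullet> F (restr (- I) x)))
        \<le> (1 + \<delta>)\<^sup>2 * (l1_norm (restr (- I) x) * R)\<^sup>2"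
      by (simp add: power2_norm_eq_inner t_def power_mult_distrib mult_ac)
  qed
  then show "(norm (G x))\<^sup>2 \<le> (1 + \<delta>)\<^sup>2 * (norm (F x))\<^sup>2 + B"
    by (simp add: B_def power2_norm_eq_inner t_def power_mult_distrib algebra_simps)
  have "- (((l1_norm t)\<^sup>2 * ((1 + \<delta>)\<^sup>2 * R\<^sup>2) + (1 + \<delta>)\<^sup>2 * (l1_norm t * R)\<^sup>2) / m)
      \<le> 1 * (G x \<bullet> G x) + (- ((1 - \<delta>)\<^sup>2)) * (F x \<bullet> F x)"
    unfolding t_def
  proof (rule sparse_mean_bound[OF blin m])
    fix J and v :: "real ^ 'p" assume "card J \<le> card I + m" "v \<in> unit_span J"
    then have "((1 - \<delta>) * norm (F v))\<^sup>2 \<le> (norm (G v))\<^sup>2"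
      using sparse \<delta> by (intro power_mono) auto
    then show "0 \<le> 1 * (G v \<bullet> G v) + (- ((1 - \<delta>)\<^sup>2)) * (F v \<bullet> F v)"
      by (simp add: power_mult_distrib power2_norm_eq_inner)
  next
    fix j
    have "(norm (G (axis j 1)))\<^sup>2 \<le> ((1 + \<delta>) * R)\<^sup>2"
      using Ge by (intro power_mono) auto
    moreover have "0 \<le> (1 - \<delta>)\<^sup>2 * (norm (F (axis j 1)))\<^sup>2"
      by simp
    ultimately have "(norm (G (axis j 1)))\<^sup>2 - (1 - \<delta>)\<^sup>2 * (norm (F (axis j 1)))\<^sup>2 \<le> ((1 + \<delta>) * R)\<^sup>2"
      by linarith
    then show "1 * (G (axis j 1) \<bullet> G (axis j 1)) + (- ((1 - \<delta>)\<^sup>2)) * (F (axis j 1) \<bullet> F (axis j 1))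
        \<le> (1 + \<delta>)\<^sup>2 * R\<^sup>2"
      by (simp add: power2_norm_eq_inner power_mult_distrib)
  next
    \<comment> \<open>Here \<open>(1 - \<delta>)\<^sup>2\<close> is weakened to
      \<open>(1 + \<delta>)\<^sup>2\<close> so that both bounds share the same
      \<open>B\<close>.\<close>
    have "(1 - \<delta>)\<^sup>2 * (norm (F t))\<^sup>2 \<le> (1 + \<delta>)\<^sup>2 * (l1_norm t * R)\<^sup>2"
      using Ft \<delta> by (intro mult_mono power_mono) auto
    then show "- (1 * (G (restr (- I) x) \<bullet> G (restr (- I) x))
        + (- ((1 - \<delta>)\<^sup>2)) * (F (restr (- I) x) \<bullet> F (restr (- I) x)))
        \<le> (1 + \<delta>)\<^sup>2 * (l1_norm (restr (- I) x) * R)\<^sup>2"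
      unfolding power2_norm_eq_inner t_def using inner_ge_zero[of "G (restr (- I) x)"] by linarith
  qed
  then show "(1 - \<delta>)\<^sup>2 * (norm (F x))\<^sup>2 - B \<le> (norm (G x))\<^sup>2"
    by (simp add: B_def power2_norm_eq_inner t_def power_mult_distrib algebra_simps)
qed

section \<open>The restricted eigenvalue bound on the tail\<close>

text \<open>Since \<open>k \<le> k'\<close>, the vector is admissible in
  \<open>RE_min s0 k' A\<close>, which bounds \<open>norm (restr I x)\<close> by
  \<open>RE_K s0 k' A * norm (A *v x)\<close>. Cauchy-Schwarz on \<open>s0\<close> coordinates and
  the cone condition then give the tail.\<close>

lemma l1_norm_tail_le_RE_K:
  fixes A :: "real ^ 'p ^ 'q"
  assumes "1 \<le> s0" "0 \<le> k" "k \<le> k'" "RE s0 k' A"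
    and "card I = s0" and cone: "l1_norm (restr (- I) x) \<le> k * l1_norm (restr I x)"
  shows "l1_norm (restr (- I) x) \<le> k * sqrt s0 * RE_K s0 k' A * norm (A *v x)"
proof (cases "x = 0")
  case True
  then show ?thesis
    by (simp add: l1_norm_def restr_def cong: if_cong)
next
  case False
  have min: "0 < RE_min s0 k' A"
    using assms(4) by (simp add: RE_def)
  have "0 \<le> l1_norm (restr I x)"
    by (simp add: l1_norm_def sum_nonneg)
  then have cone': "l1_norm (restr (- I) x) \<le> k' * l1_norm (restr I x)"
    using cone assms(3) by (meson mult_right_mono order_trans)
  then have "norm (A *v x) / norm (restr I x) \<in> RE_ratios s0 k' A"
    using False assms(5) by (auto simp: RE_ratios_def)
  then have "RE_min s0 k' A \<le> norm (A *v x) / norm (restr I x)"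
    using assms by (intro RE_min_attained(2)) auto
  moreover have "restr I x \<noteq> 0"
    using restr_nonzero False cone' by blast
  ultimately have "norm (restr I x) \<le> RE_K s0 k' A * norm (A *v x)"
    using min by (simp add: RE_K_def field_simps)
  then have "k * (sqrt s0 * norm (restr I x)) \<le> k * (sqrt s0 * (RE_K s0 k' A * norm (A *v x)))"
    using assms(2) by (intro mult_left_mono) auto
  moreover have "k * l1_norm (restr I x) \<le> k * (sqrt s0 * norm (restr I x))"
    using l1_norm_restr_le[of I x] assms by (intro mult_left_mono) auto
  ultimately show ?thesis
    using cone by (simp add: mult_ac)
qed

section \<open>Choice of the number of atoms and final estimates\<close>

theorem theorem2p1:
  fixes A :: "real ^ 'p ^ 'q"
    and \<Psi> :: "real ^ 'q ^ 'm"
    and s0 :: nat and k0 \<delta> d :: real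
    and E :: "(real ^ 'p) set"
  assumes "0 < \<delta>" and "\<delta> < 1 / 5"
    and "0 < s0" and "s0 < CARD('p)" and "0 < k0"
    and "RE s0 (3 * k0) A" and "0 < RE_K s0 (3 * k0) A"
    and "d = real s0 + real s0 * (MAX j. (norm (A *v axis j 1))\<^sup>2) *
           (16 * (RE_K s0 (3 * k0) A)\<^sup>2 * (3 * k0)\<^sup>2 * (3 * k0 + 1) / \<delta>\<^sup>2)"
    and "E = (if d < real CARD('p) then \<Union> {unit_span J | J. real (card J) \<le> d} else UNIV)"
    and "\<forall>x \<in> (\<lambda>v. A *v v) ` E.
           (1 - \<delta>) * norm x \<le> norm (\<Psi> *v x) \<and> norm (\<Psi> *v x) \<le> (1 + \<delta>) * norm x"
  shows "\<forall>x \<in> (\<lambda>v. A *v v) ` Cone s0 k0 \<inter> sphere 0 1.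
           1 - 5 * \<delta> \<le> norm (\<Psi> *v x) \<and> norm (\<Psi> *v x) \<le> 1 + 3 * \<delta>"
proof clarify
  fix x assume x: "x \<in> Cone s0 k0" "A *v x \<in> sphere 0 1"
  define F where "F = (*v) A"
  define G where "G = (\<lambda>v. \<Psi> *v (A *v v))"
  have F: "linear F" and G: "linear G"
    unfolding F_def G_def by (auto intro: linear_compose[unfolded o_def])
  define K where "K = RE_K s0 (3 * k0) A"
  define R2 where "R2 = (MAX j. (norm (A *v axis j 1))\<^sup>2)"
  define R where "R = sqrt R2"
  have R2: "(norm (F (axis j 1)))\<^sup>2 \<le> R2" for j
    unfolding R2_def F_def by (intro Max_ge) auto
  then have R2_nonneg: "0 \<le> R2"
    by (meson order_trans zero_le_power2)
  have R: "norm (F (axis j 1)) \<le> R" for j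
    using R2 by (simp add: R_def real_le_rsqrt)
  have d: "d = s0 + s0 * R2 * (16 * K\<^sup>2 * (3 * k0)\<^sup>2 * (3 * k0 + 1) / \<delta>\<^sup>2)"
    using assms(8) by (simp add: K_def R2_def)
  have sparse: "(1 - \<delta>) * norm (F v) \<le> norm (G v) \<and> norm (G v) \<le> (1 + \<delta>) * norm (F v)"
    if "real (card J) \<le> d" "v \<in> unit_span J" for J v
    using assms(9,10) that unfolding F_def G_def by (auto split: if_splits)
  have Fx: "norm (F x) = 1"
    using x by (simp add: F_def)
  obtain I where I: "card I = s0" "l1_norm (restr (- I) x) \<le> k0 * l1_norm (restr I x)"
    using x(1) by (auto simp: Cone_def)
  define t where "t = restr (- I) x"
  define L where "L = l1_norm t"
  have L0: "0 \<le> L"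
    by (simp add: L_def l1_norm_def sum_nonneg)
  have L: "L \<le> k0 * sqrt s0 * K"
    using l1_norm_tail_le_RE_K[of s0 k0 "3 * k0" A I x] I assms Fx by (simp add: L_def t_def K_def F_def)
  \<comment> \<open>\<open>M\<close> is the sparsity left for atoms once the \<open>s0\<close>
    coordinates of \<open>I\<close> are counted; it is a real number.\<close>
  define M where "M = d - s0"
  have LR: "(L * R)\<^sup>2 \<le> M * \<delta>\<^sup>2 / 16"
  proof -
    have "L\<^sup>2 \<le> (k0 * sqrt s0 * K)\<^sup>2"
      using L L0 by (intro power_mono)
    also have "\<dots> = K\<^sup>2 * k0\<^sup>2 * s0"
      by (simp add: power_mult_distrib mult_ac)
    \<comment> \<open>The factor \<open>9 * (3 * k0 + 1)\<close>, at least 1, matches the expression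
      for \<open>d\<close>, with 9 coming from \<open>(3 * k0)\<^sup>2\<close>.\<close>
    also have "\<dots> \<le> K\<^sup>2 * k0\<^sup>2 * s0 * (9 * (3 * k0 + 1))"
      using assms(5) mult_left_mono[of 1 "9 * (3 * k0 + 1)" "K\<^sup>2 * k0\<^sup>2 * s0"] by simp
    finally have "L\<^sup>2 * R2 \<le> K\<^sup>2 * k0\<^sup>2 * s0 * (9 * (3 * k0 + 1)) * R2"
      using R2_nonneg by (intro mult_right_mono)
    also have "\<dots> = M * \<delta>\<^sup>2 / 16"
      using assms(1) by (simp add: M_def d power_mult_distrib)
    finally show ?thesis
      using R2_nonneg by (simp add: R_def power_mult_distrib)
  qed
  have d_ge: "s0 \<le> d"
    using R2_nonneg assms(5) by (simp add: d)
  have "1 - 5 * \<delta> \<le> norm (G x) \<and> norm (G x) \<le> 1 + 3 * \<delta>"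
  proof (cases "L * R \<le> \<delta> / 4")
    case True
    \<comment> \<open>Here the budget \<open>M\<close> may be below one atom, but the tail is itself negligible.\<close>
    have Ge: "norm (G (axis j 1)) \<le> (1 + \<delta>) * R" for j
    proof -
      have "norm (G (axis j 1)) \<le> (1 + \<delta>) * norm (F (axis j 1))"
        using sparse[of "{j}" "axis j 1"] d_ge assms(3) axis_in_unit_span[of j "{j}" 1] by simp
      also have "\<dots> \<le> (1 + \<delta>) * R"
        using R assms(1) by (intro mult_left_mono) auto
      finally show ?thesis .
    qed
    have Ft: "norm (F t) \<le> \<delta> / 4"
      using norm_linear_le_l1_norm[OF F R, of t] True by (simp add: L_def)
    have "norm (G t) \<le> (1 + \<delta>) * (L * R)"
      using norm_linear_le_l1_norm[OF G Ge, of t] by (simp add: L_def mult_ac)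
    also have "\<dots> \<le> (1 + \<delta>) * (\<delta> / 4)"
      using True assms(1) by (intro mult_left_mono) auto
    finally have Gt: "norm (G t) \<le> (1 + \<delta>) * (\<delta> / 4)" .
    define c where "c = restr I x"
    have ct: "x = c + t"
      by (simp add: c_def t_def restr_add_restr_Compl)
    have c: "(1 - \<delta>) * norm (F c) \<le> norm (G c)" "norm (G c) \<le> (1 + \<delta>) * norm (F c)"
      using sparse[of I c] I(1) d_ge restr_in_unit_span[of I x] by (auto simp: c_def)
    have Fc: "1 - \<delta> / 4 \<le> norm (F c)" "norm (F c) \<le> 1 + \<delta> / 4"
      using Fx Ft norm_triangle_ineq[of "F c" "F t"] norm_diff_ineq[of "F c" "F t"]
      by (simp_all add: ct linear_add[OF F])
    have Gx: "norm (G x) \<le> norm (G c) + norm (G t)" "norm (G c) - norm (G t) \<le> norm (G x)"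
      using norm_triangle_ineq[of "G c" "G t"] norm_diff_ineq[of "G c" "G t"]
      by (simp_all add: ct linear_add[OF G])
    have "(1 + \<delta>) * norm (F c) \<le> (1 + \<delta>) * (1 + \<delta> / 4)"
      using Fc(2) assms(1) by (intro mult_left_mono) auto
    then have "norm (G x) \<le> (1 + \<delta>) * (1 + \<delta> / 4) + (1 + \<delta>) * (\<delta> / 4)"
      using Gx(1) Gt c(2) by linarith
    moreover have "(1 - \<delta>) * (1 - \<delta> / 4) \<le> (1 - \<delta>) * norm (F c)"
      using Fc(1) assms(2) by (intro mult_left_mono) auto
    then have "(1 - \<delta>) * (1 - \<delta> / 4) - (1 + \<delta>) * (\<delta> / 4) \<le> norm (G x)"
      using Gx(2) Gt c(1) by linarith
    \<comment> \<open>The upper bound expands to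
      \<open>1 + 3 * \<delta> / 2 + \<delta>\<^sup>2 / 2\<close>, the lower one to
      \<open>1 - 3 * \<delta> / 2\<close>.\<close>
    moreover have "\<delta> * \<delta> \<le> \<delta>"
      using assms(1,2) by (simp add: mult_left_le)
    ultimately show ?thesis
      using assms(1) unfolding ring_distribs by (intro conjI) linarith+
  next
    case False
    \<comment> \<open>The threshold \<open>\<delta> / 4\<close> squares to the
      \<open>\<delta>\<^sup>2 / 16\<close> of \<open>LR\<close>, so a larger tail forces room for at
      least one atom.\<close>
    then have "(\<delta> / 4)\<^sup>2 < (L * R)\<^sup>2"
      using assms(1) by (intro power_strict_mono) auto
    with LR have "1 * \<delta>\<^sup>2 < M * \<delta>\<^sup>2"
      by (simp add: power_divide)
    then have M: "1 < M"
      by (rule mult_right_less_imp_less) simp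
    \<comment> \<open>As \<open>1 < M\<close>, rounding down costs at most a factor 2:
      \<open>M \<le> m + 1 \<le> 2 * m\<close>.\<close>
    define m where "m = nat \<lfloor>M\<rfloor>"
    have "1 \<le> m" "m \<le> M" "M \<le> m + 1"
      using M unfolding m_def by linarith+
    then have m: "0 < m" "m \<le> M" "M \<le> 2 * m"
      by simp_all
    have sp: "(1 - \<delta>) * norm (F v) \<le> norm (G v) \<and> norm (G v) \<le> (1 + \<delta>) * norm (F v)"
      if "card J \<le> card I + m" "v \<in> unit_span J" for J v
      using that m(2) I(1) by (intro sparse[of J]) (auto simp: M_def)
    define B where "B = 2 * (1 + \<delta>)\<^sup>2 * (L * R)\<^sup>2 / m"
    have "(L * R)\<^sup>2 \<le> 2 * m * \<delta>\<^sup>2 / 16"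
      using LR m(3) mult_right_mono[of M "2 * m" "\<delta>\<^sup>2"] by simp
    then have "(L * R)\<^sup>2 / m \<le> \<delta>\<^sup>2 / 8"
      using m(1) by (simp add: field_simps)
    then have B: "B \<le> (1 + \<delta>)\<^sup>2 * \<delta>\<^sup>2 / 4"
      using mult_left_mono[of "(L * R)\<^sup>2 / m" "\<delta>\<^sup>2 / 8" "2 * (1 + \<delta>)\<^sup>2"] by (simp add: B_def mult_ac)
    have upper: "(norm (G x))\<^sup>2 \<le> (1 + \<delta>)\<^sup>2 + B" and lower: "(1 - \<delta>)\<^sup>2 - B \<le> (norm (G x))\<^sup>2"
      using sparse_isometry_transfer[where x = x, OF F G m(1) _ _ sp R] assms(1,2) Fx
      by (simp_all add: B_def L_def t_def)
    \<comment> \<open>Replacing \<open>1 + \<delta>\<^sup>2 / 4\<close> by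
      \<open>(1 + \<delta> / 2)\<^sup>2\<close> makes the upper bound a perfect square, ready for
      taking roots.\<close>
    have "(1 + \<delta>)\<^sup>2 * (1 + \<delta>\<^sup>2 / 4) \<le> (1 + \<delta>)\<^sup>2 * (1 + \<delta> / 2)\<^sup>2"
      using assms(1) by (intro mult_left_mono) (auto simp: power2_sum power_divide)
    then have "(1 + \<delta>)\<^sup>2 + (1 + \<delta>)\<^sup>2 * \<delta>\<^sup>2 / 4 \<le> ((1 + \<delta>) * (1 + \<delta> / 2))\<^sup>2"
      by (simp add: power_mult_distrib distrib_left[of "(1 + \<delta>)\<^sup>2"])
    with upper B have "(norm (G x))\<^sup>2 \<le> ((1 + \<delta>) * (1 + \<delta> / 2))\<^sup>2"
      by linarith
    then have "norm (G x) \<le> (1 + \<delta>) * (1 + \<delta> / 2)"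
      by (rule power2_le_imp_le) (use assms(1) in simp)
    moreover have "(1 + \<delta>) * (1 + \<delta> / 2) \<le> 1 + 3 * \<delta>"
      using assms(1,2) mult_left_le[of \<delta> \<delta>] by (simp add: algebra_simps)
    \<comment> \<open>With \<open>B \<le> \<delta>\<^sup>2\<close> the lower bound is at least
      \<open>1 - 2 * \<delta>\<close>, while \<open>\<delta> < 1 / 5\<close> gives
      \<open>(1 - 5 * \<delta>)\<^sup>2 \<le> 1 - 5 * \<delta>\<close>.\<close>
    moreover have "(1 - 5 * \<delta>)\<^sup>2 \<le> (norm (G x))\<^sup>2"
    proof -
      have "(1 + \<delta>)\<^sup>2 * \<delta>\<^sup>2 \<le> 2\<^sup>2 * \<delta>\<^sup>2"
        using assms(1,2) by (intro mult_right_mono power_mono) auto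
      with B have "B \<le> \<delta>\<^sup>2"
        by simp
      moreover have "25 * \<delta>\<^sup>2 \<le> 5 * \<delta>"
        using assms(1,2) mult_right_mono[of "5 * \<delta>" 1 "5 * \<delta>"] by (simp add: power2_eq_square)
      ultimately show ?thesis
        using lower assms(1) unfolding power2_diff power_mult_distrib by simp
    qed
    then have "1 - 5 * \<delta> \<le> norm (G x)"
      by (rule power2_le_imp_le) simp
    ultimately show ?thesis
      by simp
  qed
  then show "1 - 5 * \<delta> \<le> norm (\<Psi> *v (A *v x)) \<and> norm (\<Psi> *v (A *v x)) \<le> 1 + 3 * \<delta>"
    by (simp add: G_def)
qed

end
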